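(* Let $(\mathcal M, M, \overline a)$ and $(\mathcal N, N, \overline b)$ be pointed systems (in the same language $L$, of the same parameter size). If they are bisimilar, i.e. there is a bisimulation $\sim$ between $\mathcal M$ and $\mathcal N$ with $(M,\overline a)\sim(N,\overline b)$, then they are $L^{\Diamond}_\infty$-elementarily equivalent: for every $L^{\Diamond}_\infty$-formula $\phi$, $\mathcal M, M\vDash\phi[\overline a]$ if and only if $\mathcal N, N\vDash\phi[\overline b]$.
   Context: Fix a first-order finitary non-modal language $L$. A potentialist system is a collection (possibly a proper class) of $L$-structures, called worlds, together with a collection of embeddings between them, containing the identity embeddings and closed under composition. "$\pi\colon M\to M'$ in $\mathcal M$" means that $\pi$ is one of the embeddings of $\mathcal M$. (Class-sized systems are handled in a class theory such as Morse-Kelley, or using Grothendieck universes.) A pointed system is a triple $(\mathcal M,M,\overline a)$ with $\mathcal M$ a potentialist system, $M\in\mathcal M$ and $\overline a$ a finite tuple from $M$; its parameter size is the length of $\overline a$. $\pi(\overline a)$ is taken componentwise and $\overline a c$ is $\overline a$ with $c$ appended. The language $L^{\Diamond}_\infty$: formulas built from atomic $L$-formulas by negation, conjunctions and disjunctions of arbitrary set size, the quantifiers $\exists x$, $\forall x$, and the modal operators $\Diamond,\Box$, where every formula has only finitely many free variables. Satisfaction $\mathcal M,M\vDash\phi[\overline a]$: non-modal clauses are as usual in $M$; $\mathcal M,M\vDash\Diamond\phi[\overline a]$ iff there is $\pi\colon M\to M'$ in $\mathcal M$ with $\mathcal M,M'\vDash\phi[\pi(\overline a)]$; $\mathcal M,M\vDash\Box\phi[\overline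 a]$ iff for every $\pi\colon M\to M'$ in $\mathcal M$, $\mathcal M,M'\vDash\phi[\pi(\overline a)]$. A bisimulation between $\mathcal M$ and $\mathcal N$ is a non-empty relation $\sim$ matching pairs $(M,\overline a)$ with pairs $(N,\overline b)$, where $(\mathcal M,M,\overline a)$, $(\mathcal N,N,\overline b)$ are pointed systems of the same parameter size, such that whenever $(M,\overline a)\sim(N,\overline b)$: (B1) $\overline a\mapsto\overline b$ is a partial isomorphism, i.e. $\overline a$ in $M$ and $\overline b$ in $N$ satisfy the same atomic formulas; (B2) for any $c\in M$ there is $d\in N$ with $(M,\overline a c)\sim(N,\overline b d)$, and vice versa; (B3) for any $\pi\colon M\to M'$ in $\mathcal M$ there is $\rho\colon N\to N'$ in $\mathcal N$ with $(M',\pi(\overline a))\sim(N',\rho(\overline b))$, and vice versa. *)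

theory Defs
  imports "HOL-Library.FuncSet"
begin

(* Types are never empty, so the symbols of a language form subsets of the symbol types; this
   admits, e.g., purely relational languages. Constants are 0-ary function symbols. *)
record ('f, 'r) language =
  funs :: "'f set"
  rels :: "'r set"
  fun_arity :: "'f \<Rightarrow> nat"
  rel_arity :: "'r \<Rightarrow> nat"

record ('f, 'r, 'a) fo_struct =
  univ :: "'a set"
  fun_int :: "'f \<Rightarrow> 'a list \<Rightarrow> 'a"
  rel_int :: "'r \<Rightarrow> 'a list set"

definition tuples :: "nat \<Rightarrow> 'a set \<Rightarrow> 'a list set" where
  "tuples n A = {xs. length xs = n \<and> set xs \<subseteq> A}"

(* The extensional function spaces make the interpretations canonical, so equal structures are
   equal as records. The universe may be empty. *)
definition is_structure :: "('f, 'r) language \<Rightarrow> ('f, 'r, 'a) fo_struct \<Rightarrow> bool" where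
  "is_structure L M \<longleftrightarrow>
     fun_int M \<in> (\<Pi>\<^sub>E f\<in>funs L. tuples (fun_arity L f) (univ M) \<rightarrow>\<^sub>E univ M) \<and>
     rel_int M \<in> (\<Pi>\<^sub>E r\<in>rels L. Pow (tuples (rel_arity L r) (univ M)))"

definition is_embedding ::
  "('f, 'r) language \<Rightarrow> ('f, 'r, 'a) fo_struct \<Rightarrow> ('f, 'r, 'a) fo_struct \<Rightarrow> ('a \<Rightarrow> 'a) \<Rightarrow> bool" where
  "is_embedding L M M' \<pi> \<longleftrightarrow>
     \<pi> \<in> univ M \<rightarrow>\<^sub>E univ M' \<and>
     inj_on \<pi> (univ M) \<and>
     (\<forall>f\<in>funs L. \<forall>xs\<in>tuples (fun_arity L f) (univ M).
        \<pi> (fun_int M f xs) = fun_int M' f (map \<pi> xs)) \<and>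
     (\<forall>r\<in>rels L. \<forall>xs\<in>tuples (rel_arity L r) (univ M).
        xs \<in> rel_int M r \<longleftrightarrow> map \<pi> xs \<in> rel_int M' r)"

(* (M, \<pi>, M') \<in> arrows S means that \<pi> : M \<rightarrow> M' is one of the embeddings of the system. All
   universes are subsets of one arbitrary type 'a; for class-sized systems, 'a plays the role of
   the class of all sets (or of a Grothendieck universe). *)
record ('f, 'r, 'a) system =
  worlds :: "('f, 'r, 'a) fo_struct set"
  arrows :: "(('f, 'r, 'a) fo_struct \<times> ('a \<Rightarrow> 'a) \<times> ('f, 'r, 'a) fo_struct) set"

definition potentialist_system :: "('f, 'r) language \<Rightarrow> ('f, 'r, 'a) system \<Rightarrow> bool" where
  "potentialist_system L S \<longleftrightarrow>
     (\<forall>M\<in>worlds S. is_structure L M) \<and>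
     (\<forall>M \<pi> M'. (M, \<pi>, M') \<in> arrows S \<longrightarrow>
        M \<in> worlds S \<and> M' \<in> worlds S \<and> is_embedding L M M' \<pi>) \<and>
     (\<forall>M\<in>worlds S. (M, (\<lambda>x\<in>univ M. x), M) \<in> arrows S) \<and>
     (\<forall>M \<pi> M' \<rho> M''. (M, \<pi>, M') \<in> arrows S \<longrightarrow> (M', \<rho>, M'') \<in> arrows S \<longrightarrow>
        (M, compose (univ M) \<rho> \<pi>, M'') \<in> arrows S)"

definition pointed_system ::
  "('f, 'r) language \<Rightarrow> ('f, 'r, 'a) system \<Rightarrow> ('f, 'r, 'a) fo_struct \<Rightarrow> 'a list \<Rightarrow> bool" where
  "pointed_system L S M a \<longleftrightarrow>
     potentialist_system L S \<and> M \<in> worlds S \<and> set a \<subseteq> univ M"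

datatype 'f trm = Var nat | Fn 'f "'f trm list"

datatype ('f, 'r) atom = Eq "'f trm" "'f trm" | Rel 'r "'f trm list"

(* Conj I F and Disj I F are the conjunction and disjunction of the formulas F i for i \<in> I; the
   values of F outside I are irrelevant. The index type 'i is arbitrary, so that every set size
   is covered by some instance. *)
datatype ('f, 'r, 'i) fm =
    Atom "('f, 'r) atom"
  | Neg "('f, 'r, 'i) fm"
  | Conj "'i set" "'i \<Rightarrow> ('f, 'r, 'i) fm"
  | Disj "'i set" "'i \<Rightarrow> ('f, 'r, 'i) fm"
  | Ex nat "('f, 'r, 'i) fm"
  | All nat "('f, 'r, 'i) fm"
  | Dia "('f, 'r, 'i) fm"
  | Box "('f, 'r, 'i) fm"

fun fv_trm :: "'f trm \<Rightarrow> nat set" where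
  "fv_trm (Var x) = {x}"
| "fv_trm (Fn f ts) = (\<Union>t\<in>set ts. fv_trm t)"

fun fv_atom :: "('f, 'r) atom \<Rightarrow> nat set" where
  "fv_atom (Eq s t) = fv_trm s \<union> fv_trm t"
| "fv_atom (Rel r ts) = (\<Union>t\<in>set ts. fv_trm t)"

primrec fv :: "('f, 'r, 'i) fm \<Rightarrow> nat set" where
  "fv (Atom \<alpha>) = fv_atom \<alpha>"
| "fv (Neg \<phi>) = fv \<phi>"
| "fv (Conj I F) = (\<Union>i\<in>I. fv (F i))"
| "fv (Disj I F) = (\<Union>i\<in>I. fv (F i))"
| "fv (Ex x \<phi>) = fv \<phi> - {x}"
| "fv (All x \<phi>) = fv \<phi> - {x}"
| "fv (Dia \<phi>) = fv \<phi>"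
| "fv (Box \<phi>) = fv \<phi>"

fun wf_trm :: "('f, 'r) language \<Rightarrow> 'f trm \<Rightarrow> bool" where
  "wf_trm L (Var x) \<longleftrightarrow> True"
| "wf_trm L (Fn f ts) \<longleftrightarrow>
     f \<in> funs L \<and> length ts = fun_arity L f \<and> (\<forall>t\<in>set ts. wf_trm L t)"

fun wf_atom :: "('f, 'r) language \<Rightarrow> ('f, 'r) atom \<Rightarrow> bool" where
  "wf_atom L (Eq s t) \<longleftrightarrow> wf_trm L s \<and> wf_trm L t"
| "wf_atom L (Rel r ts) \<longleftrightarrow>
     r \<in> rels L \<and> length ts = rel_arity L r \<and> (\<forall>t\<in>set ts. wf_trm L t)"

primrec wf_fm :: "('f, 'r) language \<Rightarrow> ('f, 'r, 'i) fm \<Rightarrow> bool" where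
  "wf_fm L (Atom \<alpha>) \<longleftrightarrow> wf_atom L \<alpha>"
| "wf_fm L (Neg \<phi>) \<longleftrightarrow> wf_fm L \<phi>"
| "wf_fm L (Conj I F) \<longleftrightarrow> (\<forall>i\<in>I. wf_fm L (F i)) \<and> finite (\<Union>i\<in>I. fv (F i))"
| "wf_fm L (Disj I F) \<longleftrightarrow> (\<forall>i\<in>I. wf_fm L (F i)) \<and> finite (\<Union>i\<in>I. fv (F i))"
| "wf_fm L (Ex x \<phi>) \<longleftrightarrow> wf_fm L \<phi>"
| "wf_fm L (All x \<phi>) \<longleftrightarrow> wf_fm L \<phi>"
| "wf_fm L (Dia \<phi>) \<longleftrightarrow> wf_fm L \<phi>"
| "wf_fm L (Box \<phi>) \<longleftrightarrow> wf_fm L \<phi>"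

fun eval :: "('f, 'r, 'a) fo_struct \<Rightarrow> (nat \<Rightarrow> 'a) \<Rightarrow> 'f trm \<Rightarrow> 'a" where
  "eval M \<sigma> (Var x) = \<sigma> x"
| "eval M \<sigma> (Fn f ts) = fun_int M f (map (eval M \<sigma>) ts)"

fun sat_atom :: "('f, 'r, 'a) fo_struct \<Rightarrow> (nat \<Rightarrow> 'a) \<Rightarrow> ('f, 'r) atom \<Rightarrow> bool" where
  "sat_atom M \<sigma> (Eq s t) \<longleftrightarrow> eval M \<sigma> s = eval M \<sigma> t"
| "sat_atom M \<sigma> (Rel r ts) \<longleftrightarrow> map (eval M \<sigma>) ts \<in> rel_int M r"

primrec sat ::
  "('f, 'r, 'a) system \<Rightarrow> ('f, 'r, 'i) fm \<Rightarrow> ('f, 'r, 'a) fo_struct \<Rightarrow> (nat \<Rightarrow> 'a) \<Rightarrow> bool" where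
  "sat S (Atom \<alpha>) = (\<lambda>M \<sigma>. sat_atom M \<sigma> \<alpha>)"
| "sat S (Neg \<phi>) = (\<lambda>M \<sigma>. \<not> sat S \<phi> M \<sigma>)"
| "sat S (Conj I F) = (\<lambda>M \<sigma>. \<forall>i\<in>I. sat S (F i) M \<sigma>)"
| "sat S (Disj I F) = (\<lambda>M \<sigma>. \<exists>i\<in>I. sat S (F i) M \<sigma>)"
| "sat S (Ex x \<phi>) = (\<lambda>M \<sigma>. \<exists>c\<in>univ M. sat S \<phi> M (\<sigma>(x := c)))"
| "sat S (All x \<phi>) = (\<lambda>M \<sigma>. \<forall>c\<in>univ M. sat S \<phi> M (\<sigma>(x := c)))"
| "sat S (Dia \<phi>) = (\<lambda>M \<sigma>. \<exists>\<pi> M'. (M, \<pi>, M') \<in> arrows S \<and> sat S \<phi> M' (\<pi> \<circ> \<sigma>))"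
| "sat S (Box \<phi>) = (\<lambda>M \<sigma>. \<forall>\<pi> M'. (M, \<pi>, M') \<in> arrows S \<longrightarrow> sat S \<phi> M' (\<pi> \<circ> \<sigma>))"

(* xs is an admissible list of variables x_1, ..., x_n for writing a formula with free variables
   V as \<phi>(x_1, ..., x_n) and evaluating it at n-tuples. *)
definition var_list :: "nat set \<Rightarrow> nat \<Rightarrow> nat list \<Rightarrow> bool" where
  "var_list V n xs \<longleftrightarrow> distinct xs \<and> length xs = n \<and> V \<subseteq> set xs"

(* Off xs the value is unspecified, possibly outside the world at hand; it is used only when all
   free variables are in xs, and then it does not affect satisfaction. *)
definition assign :: "nat list \<Rightarrow> 'a list \<Rightarrow> nat \<Rightarrow> 'a" where
  "assign xs a x = the (map_of (zip xs a) x)"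

definition partial_isomorphism ::
  "('f, 'r) language \<Rightarrow> ('f, 'r, 'a) fo_struct \<Rightarrow> 'a list \<Rightarrow> ('f, 'r, 'b) fo_struct \<Rightarrow> 'b list \<Rightarrow> bool" where
  "partial_isomorphism L M a N b \<longleftrightarrow>
     (\<forall>\<alpha> xs. wf_atom L \<alpha> \<longrightarrow> var_list (fv_atom \<alpha>) (length a) xs \<longrightarrow>
        (sat_atom M (assign xs a) \<alpha> \<longleftrightarrow> sat_atom N (assign xs b) \<alpha>))"

definition bisimulation ::
  "('f, 'r) language \<Rightarrow> ('f, 'r, 'a) system \<Rightarrow> ('f, 'r, 'b) system \<Rightarrow>
   ((('f, 'r, 'a) fo_struct \<times> 'a list) \<times> (('f, 'r, 'b) fo_struct \<times> 'b list)) set \<Rightarrow> bool" where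
  "bisimulation L S T R \<longleftrightarrow>
     R \<noteq> {} \<and>
     (\<forall>M a N b. ((M, a), (N, b)) \<in> R \<longrightarrow>
        pointed_system L S M a \<and> pointed_system L T N b \<and> length a = length b \<and>
        partial_isomorphism L M a N b \<and>
        (\<forall>c\<in>univ M. \<exists>d\<in>univ N. ((M, a @ [c]), (N, b @ [d])) \<in> R) \<and>
        (\<forall>d\<in>univ N. \<exists>c\<in>univ M. ((M, a @ [c]), (N, b @ [d])) \<in> R) \<and>
        (\<forall>\<pi> M'. (M, \<pi>, M') \<in> arrows S \<longrightarrow>
           (\<exists>\<rho> N'. (N, \<rho>, N') \<in> arrows T \<and> ((M', map \<pi> a), (N', map \<rho> b)) \<in> R)) \<and>
        (\<forall>\<rho> N'. (N, \<rho>, N') \<in> arrows T \<longrightarrow>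
           (\<exists>\<pi> M'. (M, \<pi>, M') \<in> arrows S \<and> ((M', map \<pi> a), (N', map \<rho> b)) \<in> R)))"

definition bisimilar ::
  "('f, 'r) language \<Rightarrow>
   ('f, 'r, 'a) system \<Rightarrow> ('f, 'r, 'a) fo_struct \<Rightarrow> 'a list \<Rightarrow>
   ('f, 'r, 'b) system \<Rightarrow> ('f, 'r, 'b) fo_struct \<Rightarrow> 'b list \<Rightarrow> bool" where
  "bisimilar L S M a T N b \<longleftrightarrow> (\<exists>R. bisimulation L S T R \<and> ((M, a), (N, b)) \<in> R)"

end

theory Submission imports Defs begin

text \<open>
  The invariance of modal truth under bisimulation is an induction on formulas: negation and the
  infinitary connectives are immediate, the extension conditions on elements carry the quantifiers,
  the matching of arrows carries the modalities, and the partial isomorphisms settle the atoms.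
  What needs care is how variables are matched with entries of tuples. A bisimulation lets tuples
  grow by appending an element, but nothing allows an entry to be overwritten or dropped, whereas
  a quantifier may bind a variable that already names an entry. Once the variable is bound again,
  the old entry has no name, so the tuple need not be the value of a list of variables any more.

  The induction (\<open>bisimulation_sat_iff\<close>) therefore carries an arbitrary map \<open>p\<close> from variables to
  positions and asks only that, for each free variable \<open>y\<close>, the two assignments take \<open>y\<close> to the
  entries at position \<open>p y\<close> of the two related tuples. Quantifying over \<open>x\<close> redirects \<open>p x\<close> to the
  appended entry, whether or not \<open>x\<close> was in use before. At an atom, replacing each variable \<open>y\<close> by
  the variable with number \<open>p y\<close> gives an atom about the tuples themselves, with the variables
  \<open>0, 1, 2, \<dots>\<close> standing for the entries in their order, and the partial isomorphism applies to it
  (\<open>partial_isomorphism_sat_iff\<close>).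
\<close>

section \<open>Renaming variables in atoms\<close>

primrec rename_trm :: "(nat \<Rightarrow> nat) \<Rightarrow> 'f trm \<Rightarrow> 'f trm" where
  "rename_trm p (Var x) = Var (p x)"
| "rename_trm p (Fn f ts) = Fn f (map (rename_trm p) ts)"

primrec rename_atom :: "(nat \<Rightarrow> nat) \<Rightarrow> ('f, 'r) atom \<Rightarrow> ('f, 'r) atom" where
  "rename_atom p (Eq s t) = Eq (rename_trm p s) (rename_trm p t)"
| "rename_atom p (Rel r ts) = Rel r (map (rename_trm p) ts)"

lemma fv_rename_trm: "fv_trm (rename_trm p t) = p ` fv_trm t"
  by (induction t) auto

lemma fv_rename_atom: "fv_atom (rename_atom p \<alpha>) = p ` fv_atom \<alpha>"
  by (cases \<alpha>) (auto simp: fv_rename_trm)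

lemma wf_rename_trm: "wf_trm L (rename_trm p t) \<longleftrightarrow> wf_trm L t"
  by (induction t) auto

lemma wf_rename_atom: "wf_atom L (rename_atom p \<alpha>) \<longleftrightarrow> wf_atom L \<alpha>"
  by (cases \<alpha>) (auto simp: wf_rename_trm)

lemma eval_rename_trm:
  assumes "\<And>y. y \<in> fv_trm t \<Longrightarrow> \<sigma> (p y) = \<rho> y"
  shows "eval M \<sigma> (rename_trm p t) = eval M \<rho> t"
  using assms
proof (induction t)
  case (Fn f ts)
  have "eval M \<sigma> (rename_trm p t) = eval M \<rho> t" if "t \<in> set ts" for t
    using that Fn by auto
  then have "map (eval M \<sigma> \<circ> rename_trm p) ts = map (eval M \<rho>) ts"
    by simp
  then show ?case by (simp only: rename_trm.simps eval.simps map_map)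
qed simp

text \<open>
  The map \<open>p\<close> may identify variables, and the two assignments need to correspond only on the
  free variables. So this subsumes the usual coincidence lemma.
\<close>

lemma sat_rename_atom:
  assumes "\<And>y. y \<in> fv_atom \<alpha> \<Longrightarrow> \<sigma> (p y) = \<rho> y"
  shows "sat_atom M \<sigma> (rename_atom p \<alpha>) \<longleftrightarrow> sat_atom M \<rho> \<alpha>"
proof (cases \<alpha>)
  case (Eq s t)
  then have "eval M \<sigma> (rename_trm p s) = eval M \<rho> s" "eval M \<sigma> (rename_trm p t) = eval M \<rho> t"
    using assms by (auto intro!: eval_rename_trm)
  with Eq show ?thesis by simp
next
  case (Rel r ts)
  have "eval M \<sigma> (rename_trm p t) = eval M \<rho> t" if "t \<in> set ts" for t
    using that assms Rel by (auto intro!: eval_rename_trm)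
  then have "map (eval M \<sigma> \<circ> rename_trm p) ts = map (eval M \<rho>) ts"
    by simp
  with Rel show ?thesis by (simp only: rename_atom.simps sat_atom.simps map_map)
qed

section \<open>Assignments that read off a tuple\<close>

lemma assign_nth:
  assumes "distinct xs" "length xs = length a" "i < length a"
  shows "assign xs a (xs ! i) = a ! i"
  using assms by (simp add: assign_def map_of_zip_nth)

definition reads :: "nat set \<Rightarrow> (nat \<Rightarrow> nat) \<Rightarrow> 'a list \<Rightarrow> (nat \<Rightarrow> 'a) \<Rightarrow> bool" where
  "reads V p a \<sigma> \<longleftrightarrow> (\<forall>y\<in>V. p y < length a \<and> \<sigma> y = a ! p y)"

lemma reads_mono: "reads V p a \<sigma> \<Longrightarrow> W \<subseteq> V \<Longrightarrow> reads W p a \<sigma>"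
  by (auto simp: reads_def)

lemma reads_append:
  "length a = n \<Longrightarrow> reads (V - {x}) p a \<sigma> \<Longrightarrow> reads V (p(x := n)) (a @ [c]) (\<sigma>(x := c))"
  by (auto simp: reads_def nth_append)

lemma reads_map: "reads V p a \<sigma> \<Longrightarrow> reads V p (map \<pi> a) (\<pi> \<circ> \<sigma>)"
  by (auto simp: reads_def)

text \<open>
  A partial isomorphism is tested on lists of distinct variables, but it respects atoms under
  every way of reading the variables off the tuples: moved to position numbers, an atom can be
  evaluated along the list \<open>[0..<length a]\<close>, which is distinct even if \<open>p\<close> is not injective.
\<close>

lemma partial_isomorphism_sat_iff:
  assumes iso: "partial_isomorphism L M a N b" and len: "length a = length b"
    and wf: "wf_atom L \<alpha>"
    and \<sigma>: "reads (fv_atom \<alpha>) p a \<sigma>" and \<tau>: "reads (fv_atom \<alpha>) p b \<tau>"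
  shows "sat_atom M \<sigma> \<alpha> \<longleftrightarrow> sat_atom N \<tau> \<alpha>"
proof -
  let ?xs = "[0..<length a]"
  have eq: "assign ?xs a (p y) = \<sigma> y" "assign ?xs b (p y) = \<tau> y" if "y \<in> fv_atom \<alpha>" for y
    using that \<sigma> \<tau> len assign_nth[of ?xs a "p y"] assign_nth[of ?xs b "p y"]
    by (auto simp: reads_def)
  have "var_list (fv_atom (rename_atom p \<alpha>)) (length a) ?xs"
    using \<sigma> by (auto simp: var_list_def fv_rename_atom reads_def)
  then have "sat_atom M (assign ?xs a) (rename_atom p \<alpha>)
      \<longleftrightarrow> sat_atom N (assign ?xs b) (rename_atom p \<alpha>)"
    using iso wf by (auto simp: partial_isomorphism_def wf_rename_atom)
  then show ?thesis
    using eq by (simp add: sat_rename_atom)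
qed

lemma reads_assign:
  assumes "distinct xs" "length xs = length a"
    and "\<And>y. y \<in> V \<Longrightarrow> p y < length xs \<and> xs ! p y = y"
  shows "reads V p a (assign xs a)"
  unfolding reads_def using assms assign_nth[of xs a] by metis

section \<open>Invariance of satisfaction\<close>

text \<open>
  No pair of tuples stays fixed along a formula, since quantifiers lengthen the tuples and
  modalities move them to other worlds; what persists is that the current tuples are related by
  \<open>R\<close> and that the two assignments read them off through the same \<open>p\<close>.
\<close>

lemma bisimulation_sat_iff:
  fixes \<phi> :: "('f, 'r, 'i) fm"
  assumes bis: "bisimulation L S T R" and "wf_fm L \<phi>"
    and "((M, a), (N, b)) \<in> R"
    and "reads (fv \<phi>) p a \<sigma>" and "reads (fv \<phi>) p b \<tau>"
  shows "sat S \<phi> M \<sigma> \<longleftrightarrow> sat T \<phi> N \<tau>"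
proof -
  have len: "length a = length b"
    and iso: "partial_isomorphism L M a N b"
    and extendM: "\<And>c. c \<in> univ M \<Longrightarrow> \<exists>d\<in>univ N. ((M, a @ [c]), (N, b @ [d])) \<in> R"
    and extendN: "\<And>d. d \<in> univ N \<Longrightarrow> \<exists>c\<in>univ M. ((M, a @ [c]), (N, b @ [d])) \<in> R"
    and arrowM: "\<And>\<pi> M'. (M, \<pi>, M') \<in> arrows S \<Longrightarrow>
      \<exists>\<rho> N'. (N, \<rho>, N') \<in> arrows T \<and> ((M', map \<pi> a), (N', map \<rho> b)) \<in> R"
    and arrowN: "\<And>\<rho> N'. (N, \<rho>, N') \<in> arrows T \<Longrightarrow>
      \<exists>\<pi> M'. (M, \<pi>, M') \<in> arrows S \<and> ((M', map \<pi> a), (N', map \<rho> b)) \<in> R"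
    if "((M, a), (N, b)) \<in> R" for M a N b
    using bis that unfolding bisimulation_def by blast+
  show ?thesis
    using assms(2-)
  proof (induction \<phi> arbitrary: M a N b p \<sigma> \<tau>)
    case (Atom \<alpha>)
    then show ?case
      using partial_isomorphism_sat_iff[OF iso len] by simp
  next
    case (Neg \<phi>)
    then show ?case by simp
  next
    case (Conj I F)
    have "sat S (F i) M \<sigma> \<longleftrightarrow> sat T (F i) N \<tau>" if "i \<in> I" for i
    proof (rule Conj.IH[OF _ _ Conj.prems(2)])
      show "reads (fv (F i)) p a \<sigma>" "reads (fv (F i)) p b \<tau>"
        using Conj.prems(3,4) that by (auto elim!: reads_mono)
    qed (use Conj.prems(1) that in auto)
    then show ?case by simp
  next
    case (Disj I F)
    have "sat S (F i) M \<sigma> \<longleftrightarrow> sat T (F i) N \<tau>" if "i \<in> I" for i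
    proof (rule Disj.IH[OF _ _ Disj.prems(2)])
      show "reads (fv (F i)) p a \<sigma>" "reads (fv (F i)) p b \<tau>"
        using Disj.prems(3,4) that by (auto elim!: reads_mono)
    qed (use Disj.prems(1) that in auto)
    then show ?case by simp
  next
    case (Ex x \<phi>)
    have step: "sat S \<phi> M (\<sigma>(x := c)) \<longleftrightarrow> sat T \<phi> N (\<tau>(x := d))"
      if "((M, a @ [c]), (N, b @ [d])) \<in> R" for c d
      using Ex.prems that len[OF Ex.prems(2)]
      by (intro Ex.IH[of _ "a @ [c]" _ "b @ [d]" "p(x := length a)"])
        (auto intro: reads_append simp del: fun_upd_apply)
    show ?case
      using step extendM[OF Ex.prems(2)] extendN[OF Ex.prems(2)] by (simp del: fun_upd_apply) blast
  next
    case (All x \<phi>)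
    have step: "sat S \<phi> M (\<sigma>(x := c)) \<longleftrightarrow> sat T \<phi> N (\<tau>(x := d))"
      if "((M, a @ [c]), (N, b @ [d])) \<in> R" for c d
      using All.prems that len[OF All.prems(2)]
      by (intro All.IH[of _ "a @ [c]" _ "b @ [d]" "p(x := length a)"])
        (auto intro: reads_append simp del: fun_upd_apply)
    show ?case
      using step extendM[OF All.prems(2)] extendN[OF All.prems(2)] by (simp del: fun_upd_apply) blast
  next
    case (Dia \<phi>)
    have step: "sat S \<phi> M' (\<pi> \<circ> \<sigma>) \<longleftrightarrow> sat T \<phi> N' (\<rho> \<circ> \<tau>)"
      if "((M', map \<pi> a), (N', map \<rho> b)) \<in> R" for M' \<pi> N' \<rho>
      using Dia.prems(1,3,4)
      by (intro Dia.IH[OF _ that] reads_map) (simp_all only: wf_fm.simps fv.simps)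
    show ?case
      using step arrowM[OF Dia.prems(2)] arrowN[OF Dia.prems(2)] by simp blast
  next
    case (Box \<phi>)
    have step: "sat S \<phi> M' (\<pi> \<circ> \<sigma>) \<longleftrightarrow> sat T \<phi> N' (\<rho> \<circ> \<tau>)"
      if "((M', map \<pi> a), (N', map \<rho> b)) \<in> R" for M' \<pi> N' \<rho>
      using Box.prems(1,3,4)
      by (intro Box.IH[OF _ that] reads_map) (simp_all only: wf_fm.simps fv.simps)
    show ?case
      using step arrowM[OF Box.prems(2)] arrowN[OF Box.prems(2)] by simp blast
  qed
qed

theorem theorem21:
  fixes L :: "('f, 'r) language"
    and S :: "('f, 'r, 'a) system" and M :: "('f, 'r, 'a) fo_struct" and a :: "'a list"
    and T :: "('f, 'r, 'b) system" and N :: "('f, 'r, 'b) fo_struct" and b :: "'b list"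
  assumes "pointed_system L S M a"
    and "pointed_system L T N b"
    and "length a = length b"
    and "bisimilar L S M a T N b"
  shows "\<forall>(\<phi> :: ('f, 'r, 'i) fm) xs. wf_fm L \<phi> \<longrightarrow> var_list (fv \<phi>) (length a) xs \<longrightarrow>
    (sat S \<phi> M (assign xs a) \<longleftrightarrow> sat T \<phi> N (assign xs b))"
proof (intro allI impI)
  fix \<phi> :: "('f, 'r, 'i) fm" and xs
  assume wf: "wf_fm L \<phi>" and xs: "var_list (fv \<phi>) (length a) xs"
  obtain R where R: "bisimulation L S T R" "((M, a), (N, b)) \<in> R"
    using assms(4) by (auto simp: bisimilar_def)
  \<comment> \<open>As \<open>xs\<close> covers the free variables, \<open>p\<close> can send each of them to its place in \<open>xs\<close>.\<close>
  have "\<forall>y\<in>fv \<phi>. \<exists>i < length xs. xs ! i = y"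
    using xs by (auto simp: var_list_def in_set_conv_nth)
  then obtain p where p: "\<And>y. y \<in> fv \<phi> \<Longrightarrow> p y < length xs \<and> xs ! p y = y"
    by metis
  show "sat S \<phi> M (assign xs a) \<longleftrightarrow> sat T \<phi> N (assign xs b)"
  proof (rule bisimulation_sat_iff[OF R(1) wf R(2)])
    show "reads (fv \<phi>) p a (assign xs a)"
      using p xs by (intro reads_assign) (auto simp: var_list_def)
    show "reads (fv \<phi>) p b (assign xs b)"
      using p xs assms(3) by (intro reads_assign) (auto simp: var_list_def)
  qed
qed

end
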